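(* Let $A,B_1,\dots,B_k$ be linear endomorphisms of $V$, each self-adjoint or skew-adjoint, arranged in one of the following two collections of $k$ chain complexes of length two: either (1) $V\xrightarrow{A}V\xrightarrow{B_i}V$ for all $i=1,\dots,k$, i.e. $B_iA=0$ for all $i$; or (2) $V\xrightarrow{B_i}V\xrightarrow{A}V$ for all $i=1,\dots,k$, i.e. $AB_i=0$ for all $i$. Suppose $$0=R_A+\sum_{i=1}^k\epsilon_iR_{B_i},\qquad \epsilon_i\in\{-1,1\}.$$ Then $R_A=0$. Moreover, if $A=-A^*$, then for each $i$ for which the corresponding sequence is exact (i.e. $\operatorname{Im}A=\ker B_i$ in case (1), respectively $\operatorname{Im}B_i=\ker A$ in case (2)), the operator $B_i$ is invertible.
   Context: $V$ is a finite-dimensional real vector space, $\phi$ a positive definite inner product on $V$, and $A^*$ the adjoint of $A$ with respect to $\phi$. For an endomorphism $A$ of $V$, $$R^S_{A}(x,y,z,w)= \phi (Ax,w) \phi (Ay,z) - \phi (Ax,z) \phi (Ay,w),$$ $$R^{\Lambda}_{A} (x,y,z,w) =\phi (Ax,w) \phi (Ay,z) - \phi (Ax,z) \phi (Ay,w) -2 \phi (Ax,y) \phi (Az,w).$$ The symbol $R_A$ without superscript means $R^S_A$ (symmetric build) if $A=A^*$ and $R^{\Lambda}_A$ (anti-symmetric build) if $A=-A^*$; the builds of the different tensors may differ. (For $A=0$ both are zero.) *)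

theory Defs
  imports "HOL-Analysis.Analysis"
begin

text \<open>The vector space with its positive definite inner product is a type of class
  \<open>real_inner\<close>; finite-dimensionality is a separate hypothesis. The class
  \<open>euclidean_space\<close> is not used because it excludes the zero space.\<close>

definition self_adjoint :: "('a::real_inner \<Rightarrow> 'a) \<Rightarrow> bool" where
  "self_adjoint A \<longleftrightarrow> A = adjoint A"

definition skew_adjoint :: "('a::real_inner \<Rightarrow> 'a) \<Rightarrow> bool" where
  "skew_adjoint A \<longleftrightarrow> A = (\<lambda>x. - adjoint A x)"

definition R_sym :: "('a::real_inner \<Rightarrow> 'a) \<Rightarrow> 'a \<Rightarrow> 'a \<Rightarrow> 'a \<Rightarrow> 'a \<Rightarrow> real" where
  "R_sym A x y z w = (A x \<bullet> w) * (A y \<bullet> z) - (A x \<bullet> z) * (A y \<bullet> w)"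

definition R_anti :: "('a::real_inner \<Rightarrow> 'a) \<Rightarrow> 'a \<Rightarrow> 'a \<Rightarrow> 'a \<Rightarrow> 'a \<Rightarrow> real" where
  "R_anti A x y z w =
     (A x \<bullet> w) * (A y \<bullet> z) - (A x \<bullet> z) * (A y \<bullet> w) - 2 * (A x \<bullet> y) * (A z \<bullet> w)"

text \<open>Meaningful only for self-adjoint or skew-adjoint \<open>A\<close>. The only operator that is both
  is \<open>0\<close>, for which both builds vanish, so the order of the test is immaterial.\<close>

definition R_build :: "('a::real_inner \<Rightarrow> 'a) \<Rightarrow> 'a \<Rightarrow> 'a \<Rightarrow> 'a \<Rightarrow> 'a \<Rightarrow> real" where
  "R_build A = (if self_adjoint A then R_sym A else R_anti A)"

text \<open>\<open>V \<rightarrow> V \<rightarrow> V\<close>, with \<open>f\<close> the first map and \<open>g\<close> the second;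
  exactness is exactness at the middle term.\<close>

definition chain_complex2 :: "('a::real_vector \<Rightarrow> 'a) \<Rightarrow> ('a \<Rightarrow> 'a) \<Rightarrow> bool" where
  "chain_complex2 f g \<longleftrightarrow> (\<forall>x. g (f x) = 0)"

definition exact2 :: "('a::real_vector \<Rightarrow> 'a) \<Rightarrow> ('a \<Rightarrow> 'a) \<Rightarrow> bool" where
  "exact2 f g \<longleftrightarrow> range f = g -` {0}"

definition invertible_endo :: "('a::real_vector \<Rightarrow> 'a) \<Rightarrow> bool" where
  "invertible_endo f \<longleftrightarrow> (\<exists>g. linear g \<and> g \<circ> f = id \<and> f \<circ> g = id)"

end

theory Submission
  imports Defs
begin

text \<open>
  Since \<open>A\<close> and every \<open>B\<^sub>i\<close> equal their adjoints up to sign, \<open>A B\<^sub>i = 0\<close> and \<open>B\<^sub>i A = 0\<close> are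
  equivalent, so both collections of complexes lead to the same situation. Both builds of \<open>R\<close> have
  \<open>B\<^sub>i x\<close> as a factor of every summand, so feeding a vector \<open>A u\<close> into the first slot of the linear
  dependence kills all terms except that of \<open>A\<close>, and \<open>R\<^sub>A (A u, y, z, w) = 0\<close> remains for all
  arguments. This information on \<open>A\<close> alone suffices, by \<open>R_sym_eq_zero_if_zero_on_range\<close> and
  \<open>skew_eq_zero_if_R_anti_zero_on_range\<close>.

  If \<open>A\<close> is self-adjoint and nonzero, then some \<open>v = A (A u)\<close> is nonzero, because
  \<open>A u \<bullet> A u = u \<bullet> A (A u)\<close>. The identity
  \<open>R\<^sub>A (A u, y, z, v) = 0\<close> says that every \<open>A y\<close> is a multiple of \<open>v\<close>; a rank one operator
  has \<open>R\<^sub>A = 0\<close>. If \<open>A\<close> is skew-adjoint, then \<open>R\<^sub>A (x, y, y, x) = 3 (A x \<bullet> y)\<^sup>2\<close>, which forces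
  \<open>A (A u) = 0\<close> for all \<open>u\<close> and hence \<open>A = 0\<close>. Exactness at the middle term next to a zero map then
  says that \<open>B\<^sub>i\<close> is injective or surjective, and in finite dimension this is invertibility.
\<close>

text \<open>
  \<^const>\<open>adjoint\<close> is a choice among the maps that satisfy the defining equation, so
  such a map has to be exhibited. A finite orthogonal spanning set \<open>C\<close> yields one by Fourier
  expansion. A zero vector may occur in \<open>C\<close>: its coefficient, a division by zero, multiplies the
  vector zero, and \<open>f 0 = 0\<close>.
\<close>

lemma inner_adjoint:
  fixes f :: "'a::real_inner \<Rightarrow> 'a"
  assumes fin: "\<exists>S::'a set. finite S \<and> span S = UNIV" and f: "linear f"
  shows "f x \<bullet> y = x \<bullet> adjoint f y"
proof -
  from fin obtain S :: "'a set" where S: "finite S" "span S = UNIV" by blast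
  obtain C :: "'a set" where C: "finite C" "span C = UNIV" "pairwise orthogonal C"
    using basis_orthogonal[OF S(1)] S(2) by metis
  define f' where "f' y = (\<Sum>c\<in>C. ((f c \<bullet> y) / (c \<bullet> c)) *\<^sub>R c)" for y
  have on_basis: "f b \<bullet> y = b \<bullet> f' y" if b: "b \<in> C" for b y
  proof -
    have "b \<bullet> f' y = (\<Sum>c\<in>C. ((f c \<bullet> y) / (c \<bullet> c)) * (b \<bullet> c))"
      by (simp add: f'_def inner_sum_right)
    also have "\<dots> = (\<Sum>c\<in>C. if c = b then f b \<bullet> y else 0)"
    proof (rule sum.cong)
      fix c assume c: "c \<in> C"
      show "((f c \<bullet> y) / (c \<bullet> c)) * (b \<bullet> c) = (if c = b then f b \<bullet> y else 0)"
        using C(3) b c linear_0[OF f]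
        by (cases "b = 0") (auto simp: pairwise_def orthogonal_def)
    qed simp
    also have "\<dots> = f b \<bullet> y" using b C(1) by simp
    finally show ?thesis by simp
  qed
  have "f x \<bullet> y = x \<bullet> f' y" for x y
  proof -
    have "x \<in> span C" using C(2) by simp
    then show ?thesis
    proof (induction rule: span_induct_alt)
      case base
      then show ?case using linear_0[OF f] by simp
    next
      case (step c b x)
      then show ?case
        by (simp add: linear_add[OF f] linear_cmul[OF f] inner_add_left on_basis)
    qed
  qed
  then have "\<exists>f'. \<forall>x y. f x \<bullet> y = x \<bullet> f' y" by blast
  from someI_ex[OF this] show ?thesis unfolding adjoint_def by blast
qed

lemma self_adjoint_inner:
  fixes f :: "'a::real_inner \<Rightarrow> 'a"
  assumes "\<exists>S::'a set. finite S \<and> span S = UNIV" "linear f" "self_adjoint f"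
  shows "f x \<bullet> y = x \<bullet> f y"
  using inner_adjoint[OF assms(1,2)] assms(3) unfolding self_adjoint_def by metis

lemma skew_adjoint_inner:
  fixes f :: "'a::real_inner \<Rightarrow> 'a"
  assumes "\<exists>S::'a set. finite S \<and> span S = UNIV" "linear f" "skew_adjoint f"
  shows "f x \<bullet> y = - (x \<bullet> f y)"
proof -
  have "f y = - adjoint f y" using assms(3) unfolding skew_adjoint_def by metis
  then show ?thesis using inner_adjoint[OF assms(1,2)] by simp
qed

text \<open>The adjoint of \<open>A B\<close> is \<open>B A\<close> up to a sign, hence the absolute values in the proof.\<close>

lemma chain_complex2_swap:
  fixes A B :: "'a::real_inner \<Rightarrow> 'a"
  assumes fin: "\<exists>S::'a set. finite S \<and> span S = UNIV"
    and A: "linear A" "self_adjoint A \<or> skew_adjoint A"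
    and B: "linear B" "self_adjoint B \<or> skew_adjoint B"
    and BA: "chain_complex2 B A"
  shows "chain_complex2 A B"
  unfolding chain_complex2_def
proof
  fix x
  let ?y = "B (A x)"
  have AB0: "A (B ?y) = 0" using BA unfolding chain_complex2_def by blast
  have "\<bar>?y \<bullet> ?y\<bar> = \<bar>A x \<bullet> B ?y\<bar>"
    using B(2) self_adjoint_inner[OF fin B(1), of "A x" ?y]
      skew_adjoint_inner[OF fin B(1), of "A x" ?y] by (metis abs_minus_cancel)
  also have "\<dots> = \<bar>x \<bullet> A (B ?y)\<bar>"
    using A(2) self_adjoint_inner[OF fin A(1), of x "B ?y"]
      skew_adjoint_inner[OF fin A(1), of x "B ?y"] by (metis abs_minus_cancel)
  finally show "?y = 0" using AB0 by simp
qed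

text \<open>
  An independent subset of the finite spanning set is a finite basis, so the rank argument for
  endomorphisms of finite-dimensional spaces applies.
\<close>

lemma invertible_endo_if_inj_or_surj:
  fixes f :: "'a::real_vector \<Rightarrow> 'a"
  assumes fin: "\<exists>S::'a set. finite S \<and> span S = UNIV"
    and f: "linear f" and "inj f \<or> surj f"
  shows "invertible_endo f"
proof -
  from fin obtain S :: "'a set" where S: "finite S" "span S = UNIV" by blast
  obtain C where C: "C \<subseteq> S" "independent C" "S \<subseteq> span C"
    using maximal_independent_subset[of S] by blast
  have "span C = UNIV" using C(3) S(2) span_minimal[OF C(3) subspace_span] by auto
  moreover have "finite C" using C(1) S(1) finite_subset by blast
  ultimately interpret V: finite_dimensional_vector_space_pair
      "(*\<^sub>R) :: real \<Rightarrow> 'a \<Rightarrow> 'a" C "(*\<^sub>R) :: real \<Rightarrow> 'a \<Rightarrow> 'a" C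
    using C(2)
    by unfold_locales
      (auto simp: dependent_raw_def span_raw_def algebra_simps)
  have f': "Vector_Spaces.linear (*\<^sub>R) (*\<^sub>R) f" using f by (simp add: linear_def)
  from assms(3) have "\<exists>g. linear g \<and> (\<forall>x. g (f x) = x) \<and> (\<forall>x. f (g x) = x)"
    using V.linear_injective_isomorphism[OF f' _ refl]
      V.linear_surjective_isomorphism[OF f' _ refl]
    by (auto simp: linear_def)
  then show ?thesis unfolding invertible_endo_def by (auto simp: fun_eq_iff)
qed

lemma R_build_eq_zero_if_kernel: "C x = 0 \<Longrightarrow> R_build C x y z w = 0"
  by (simp add: R_build_def R_sym_def R_anti_def)

text \<open>
  The hypothesis makes \<open>A\<close> zero or an operator of rank one. The second case is read off from
  \<open>R\<^sub>A (A u, y, z, v) = (v \<bullet> v) (A y \<bullet> z) - (v \<bullet> z) (A y \<bullet> v)\<close> with \<open>v = A (A u)\<close>.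
\<close>

lemma R_sym_eq_zero_if_zero_on_range:
  fixes A :: "'a::real_inner \<Rightarrow> 'a"
  assumes sym: "\<And>x y. A x \<bullet> y = x \<bullet> A y"
    and zero: "\<And>u y z w. R_sym A (A u) y z w = 0"
  shows "R_sym A x y z w = 0"
proof (cases "\<exists>u. A (A u) \<noteq> 0")
  case True
  then obtain u where u: "A (A u) \<noteq> 0" by blast
  define v where "v = A (A u)"
  define c where "c y = (A y \<bullet> v) / (v \<bullet> v)" for y
  have vv: "v \<bullet> v \<noteq> 0" using u by (simp add: v_def)
  have "A y \<bullet> z = c y * (v \<bullet> z)" for y z
    using zero[of u y z v] vv by (simp add: R_sym_def c_def field_simps flip: v_def)
  then show ?thesis by (simp add: R_sym_def)
next
  case False
  have "A x \<bullet> A x = 0" for x using sym[of x "A x"] False by simp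
  then show ?thesis by (simp add: R_sym_def)
qed

text \<open>
  For skew \<open>A\<close> one has \<open>A x \<bullet> x = 0\<close> and \<open>A y \<bullet> x = - (A x \<bullet> y)\<close>, so
  \<open>R\<^sub>A (x, y, y, x) = 3 (A x \<bullet> y)\<^sup>2\<close>: the tensor detects \<open>A x\<close>.
\<close>

lemma skew_eq_zero_if_R_anti_zero_on_range:
  fixes A :: "'a::real_inner \<Rightarrow> 'a"
  assumes skew: "\<And>x y. A x \<bullet> y = - (x \<bullet> A y)"
    and zero: "\<And>u y z w. R_anti A (A u) y z w = 0"
  shows "A u = 0"
proof -
  have diag: "A x \<bullet> x = 0" for x using skew[of x x] by (simp add: inner_commute)
  have "R_anti A x y y x = 3 * (A x \<bullet> y)\<^sup>2" for x y
    using skew[of y x] diag by (simp add: R_anti_def power2_eq_square inner_commute)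
  from this[of "A u" "A (A u)"] have "A (A u) = 0" using zero by simp
  then have "A u \<bullet> A u = 0" using skew[of u "A u"] by simp
  then show ?thesis by simp
qed

theorem theorem5p5:
  fixes A :: "'a::real_inner \<Rightarrow> 'a"
    and B :: "nat \<Rightarrow> 'a \<Rightarrow> 'a"
    and \<epsilon> :: "nat \<Rightarrow> real"
    and k :: nat
  assumes fin_dim: "\<exists>S::'a set. finite S \<and> span S = UNIV"
    and lin_A: "linear A"
    and lin_B: "\<forall>i\<in>{1..k}. linear (B i)"
    and adj_A: "self_adjoint A \<or> skew_adjoint A"
    and adj_B: "\<forall>i\<in>{1..k}. self_adjoint (B i) \<or> skew_adjoint (B i)"
    and complexes: "(\<forall>i\<in>{1..k}. chain_complex2 A (B i)) \<or> (\<forall>i\<in>{1..k}. chain_complex2 (B i) A)"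
    and eps: "\<forall>i\<in>{1..k}. \<epsilon> i \<in> {-1, 1}"
    and dependence: "\<forall>x y z w. 0 = R_build A x y z w + (\<Sum>i=1..k. \<epsilon> i * R_build (B i) x y z w)"
  shows "(\<forall>x y z w. R_build A x y z w = 0) \<and>
    (skew_adjoint A \<longrightarrow>
      ((\<forall>i\<in>{1..k}. chain_complex2 A (B i)) \<longrightarrow>
         (\<forall>i\<in>{1..k}. exact2 A (B i) \<longrightarrow> invertible_endo (B i))) \<and>
      ((\<forall>i\<in>{1..k}. chain_complex2 (B i) A) \<longrightarrow>
         (\<forall>i\<in>{1..k}. exact2 (B i) A \<longrightarrow> invertible_endo (B i))))"
proof -
  have BA: "B i (A u) = 0" if "i \<in> {1..k}" for i u
  proof -
    have "chain_complex2 (B i) A \<Longrightarrow> chain_complex2 A (B i)"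
      using chain_complex2_swap[OF fin_dim lin_A adj_A] lin_B adj_B that by blast
    then have "chain_complex2 A (B i)" using complexes that by blast
    then show ?thesis by (simp add: chain_complex2_def)
  qed
  have zero: "R_build A (A u) y z w = 0" for u y z w
  proof -
    have "(\<Sum>i=1..k. \<epsilon> i * R_build (B i) (A u) y z w) = 0"
      by (intro sum.neutral ballI) (simp add: BA R_build_eq_zero_if_kernel)
    then show ?thesis using dependence[rule_format, of "A u" y z w] by simp
  qed
  have A0: "A u = 0" if skew: "skew_adjoint A" for u
    \<comment> \<open>A skew-adjoint \<open>A\<close> carries the symmetric build exactly when it is also self-adjoint, hence zero.\<close>
  proof (cases "self_adjoint A")
    case True
    have "A u \<bullet> A u = 0"
      using self_adjoint_inner[OF fin_dim lin_A True, of u "A u"]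
        skew_adjoint_inner[OF fin_dim lin_A skew, of u "A u"] by simp
    then show ?thesis by simp
  next
    case False
    then show ?thesis
      using skew_eq_zero_if_R_anti_zero_on_range[of A u] skew_adjoint_inner[OF fin_dim lin_A skew]
        zero by (simp add: R_build_def)
  qed
  have "R_build A x y z w = 0" for x y z w
  proof (cases "self_adjoint A")
    case True
    then show ?thesis
      using R_sym_eq_zero_if_zero_on_range[of A] self_adjoint_inner[OF fin_dim lin_A True] zero
      by (simp add: R_build_def)
  next
    case False
    then show ?thesis using adj_A A0 R_build_eq_zero_if_kernel by blast
  qed
  moreover have "invertible_endo (B i)"
    if skew: "skew_adjoint A" and i: "i \<in> {1..k}" and exact: "exact2 A (B i)" for i
  proof -
    have "B i x = 0 \<longleftrightarrow> x = 0" for x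
      using exact A0[OF skew] by (auto simp: exact2_def set_eq_iff image_iff)
    then have "inj (B i)" using lin_B i linear_injective_0 by blast
    then show ?thesis using invertible_endo_if_inj_or_surj[OF fin_dim] lin_B i by blast
  qed
  moreover have "invertible_endo (B i)"
    if skew: "skew_adjoint A" and i: "i \<in> {1..k}" and exact: "exact2 (B i) A" for i
  proof -
    have "surj (B i)" using exact A0[OF skew] by (auto simp: exact2_def)
    then show ?thesis using invertible_endo_if_inj_or_surj[OF fin_dim] lin_B i by blast
  qed
  ultimately show ?thesis by blast
qed

end
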